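(* Let $B\subseteq M_2(\mathbb{R})$ be a rational quaternion algebra with fixed embedding, $I\subseteq B$ an ideal (full lattice), $\tau\in\mathcal{H}$, and $A_\tau=\mathbb{C}^2/I\binom{\tau}{1}$. Say that a complex line $\ell\subseteq\mathbb{C}^2$ gives an Abelian subvariety of $A_\tau$ if $\ell\cap I\binom{\tau}{1}$ is a lattice of rank $2$ in $\ell$; the slope of $\mathbb{C}\binom{\tau_0}{1}$ is $\tau_0\in\mathbb{C}$ and that of $\mathbb{C}\binom10$ is $\infty$. Then: (i) If $A_\tau$ has CM, the lines with finite non-real slope giving Abelian subvarieties of $A_\tau$ are exactly the lines $\mathbb{C}\binom{\tau_0}{1}$ with $\tau_0\in\mathcal{H}\cup\overline{\mathcal{H}}$ for which there is $\gamma\in B$ of nonzero norm with $\gamma\tau=\tau_0$. (ii) If $A_\tau$ has no CM, no line of non-real slope gives an Abelian subvariety of $A_\tau$. (iii) If $B=M_2(\mathbb{Q})$ with its standard embedding, a line of slope in $\mathbb{P}^1(\mathbb{R})$ gives an Abelian subvariety of $A_\tau$ if and only if its slope lies in $\mathbb{P}^1(\mathbb{Q})$. (iv) If $B$ is a division algebra, no line of real or infinite slope gives an Abelian subvariety of $A_\tau$.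
   Context: $B$ is a 4-dimensional central simple $\mathbb{Q}$-algebra identified with its image under a fixed embedding into $M_2(\mathbb{R})$ with $B\otimes\mathbb{R}\cong M_2(\mathbb{R})$; norm = determinant. For $\tau=x+iy$, $J_\tau=\frac1y\binom{x\ -|\tau|^2}{1\ \ -x}$. $A_\tau$ "has CM" means some nonzero real multiple of $J_\tau$ lies in $B$ (equivalently, $A_\tau$ has an endomorphism commuting with left multiplication by $\{x\in B:xI\subseteq I\}$ that is not an integer). Matrices $\binom{a\ b}{c\ d}$ act on $\mathbb{C}\setminus\mathbb{R}$ by $\tau\mapsto\frac{a\tau+b}{c\tau+d}$. *)

theory Defs
  imports "HOL-Analysis.Analysis"
begin

interpretation rat_vs: vector_space "\<lambda>(q::rat) (x::'a::real_vector). of_rat q *\<^sub>R x"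
  by unfold_locales (simp_all add: of_rat_add of_rat_mult algebra_simps)

interpretation int_mod: module "\<lambda>(n::int) (x::'a::real_vector). of_int n *\<^sub>R x"
  by unfold_locales (simp_all add: algebra_simps)

definition subalgebra_over_Q :: "(real^2^2) set \<Rightarrow> bool" where
  "subalgebra_over_Q B \<longleftrightarrow>
     rat_vs.subspace B \<and> mat 1 \<in> B \<and> (\<forall>x\<in>B. \<forall>y\<in>B. x ** y \<in> B)"

definition two_sided_ideal :: "(real^2^2) set \<Rightarrow> (real^2^2) set \<Rightarrow> bool" where
  "two_sided_ideal B J \<longleftrightarrow>
     J \<subseteq> B \<and> int_mod.subspace J \<and> (\<forall>b\<in>B. \<forall>x\<in>J. b ** x \<in> J \<and> x ** b \<in> J)"

definition central_over_Q :: "(real^2^2) set \<Rightarrow> bool" where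
  "central_over_Q B \<longleftrightarrow>
     {x \<in> B. \<forall>y\<in>B. x ** y = y ** x} = {of_rat q *\<^sub>R mat 1 | q. True}"

definition simple_algebra :: "(real^2^2) set \<Rightarrow> bool" where
  "simple_algebra B \<longleftrightarrow> (\<forall>J. two_sided_ideal B J \<longrightarrow> J = {0} \<or> J = B)"

text \<open>
  A rational quaternion algebra, identified with its image in the real 2 by 2 matrices.
  The last condition says that the inclusion induces an isomorphism from the scalar extension
  of \<open>B\<close> to the reals onto the full matrix algebra: the induced map is
  surjective iff the real span of \<open>B\<close> is everything, and both sides have real dimension 4.
\<close>

definition quaternion_algebra :: "(real^2^2) set \<Rightarrow> bool" where
  "quaternion_algebra B \<longleftrightarrow>
     subalgebra_over_Q B \<and> rat_vs.dim B = 4 \<and> central_over_Q B \<and> simple_algebra B \<and>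
     span B = UNIV"

definition division_algebra :: "(real^2^2) set \<Rightarrow> bool" where
  "division_algebra B \<longleftrightarrow> (\<forall>x\<in>B. x \<noteq> 0 \<longrightarrow> (\<exists>y\<in>B. x ** y = mat 1 \<and> y ** x = mat 1))"

definition M2Q :: "(real^2^2) set" where
  "M2Q = {M. \<forall>i j. M $ i $ j \<in> \<rat>}"

text \<open>
  Ideals are full lattices: finitely generated subgroups of \<open>B\<close> containing a rational basis.
  No stability under multiplication by a prescribed order is imposed.
\<close>

definition full_lattice :: "(real^2^2) set \<Rightarrow> (real^2^2) set \<Rightarrow> bool" where
  "full_lattice B I \<longleftrightarrow>
     I \<subseteq> B \<and> (\<exists>S. finite S \<and> int_mod.span S = I) \<and> rat_vs.span I = B"

definition upper_half_plane :: "complex set" where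
  "upper_half_plane = {z. Im z > 0}"

definition lower_half_plane :: "complex set" where
  "lower_half_plane = {z. Im z < 0}"

definition act :: "real^2^2 \<Rightarrow> complex \<Rightarrow> complex" where
  "act M = moebius (of_real (M$1$1)) (of_real (M$1$2)) (of_real (M$2$1)) (of_real (M$2$2))"

definition complexify :: "real^2^2 \<Rightarrow> complex^2^2" where
  "complexify M = (\<chi> i j. of_real (M $ i $ j))"

text \<open>The lattice with quotient \<open>A\<^sub>\<tau>\<close>.\<close>

definition period_lattice :: "(real^2^2) set \<Rightarrow> complex \<Rightarrow> (complex^2) set" where
  "period_lattice I \<tau> = (\<lambda>M. complexify M *v vector [\<tau>, 1]) ` I"

definition J_mat :: "complex \<Rightarrow> real^2^2" where
  "J_mat \<tau> = (1 / Im \<tau>) *\<^sub>R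
     vector [vector [Re \<tau>, - ((cmod \<tau>)\<^sup>2)], vector [1, - Re \<tau>]]"

text \<open>Whether \<open>A\<^sub>\<tau>\<close> has CM does not depend on the choice of the lattice in \<open>B\<close>.\<close>

definition has_CM :: "(real^2^2) set \<Rightarrow> complex \<Rightarrow> bool" where
  "has_CM B \<tau> \<longleftrightarrow> (\<exists>r::real. r \<noteq> 0 \<and> r *\<^sub>R J_mat \<tau> \<in> B)"

definition complex_line :: "(complex^2) set \<Rightarrow> bool" where
  "complex_line l \<longleftrightarrow> vec.subspace l \<and> vec.dim l = 1"

text \<open>
  A lattice of rank \<open>n\<close> in \<open>V\<close> is the group generated by \<open>n\<close>
  vectors of \<open>V\<close> that are linearly independent over the reals.
\<close>

definition lattice_of_rank_in :: "nat \<Rightarrow> 'a::real_vector set \<Rightarrow> 'a set \<Rightarrow> bool" where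
  "lattice_of_rank_in n V L \<longleftrightarrow>
     (\<exists>S. finite S \<and> card S = n \<and> S \<subseteq> V \<and> independent S \<and> L = int_mod.span S)"

definition gives_abelian_subvariety ::
    "(real^2^2) set \<Rightarrow> complex \<Rightarrow> (complex^2) set \<Rightarrow> bool" where
  "gives_abelian_subvariety I \<tau> l \<longleftrightarrow> lattice_of_rank_in 2 l (l \<inter> period_lattice I \<tau>)"

datatype slope = Finite complex | Infinite

fun line_of_slope :: "slope \<Rightarrow> (complex^2) set" where
  "line_of_slope (Finite z) = vec.span {vector [z, 1]}"
| "line_of_slope Infinite = vec.span {vector [1, 0]}"

text \<open>Meaningful for complex lines only; there the slope exists and is unique.\<close>

definition slope_of :: "(complex^2) set \<Rightarrow> slope" where
  "slope_of l = (THE s. l = line_of_slope s)"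

definition P1_real :: "slope set" where
  "P1_real = insert Infinite (Finite ` \<real>)"

definition P1_rat :: "slope set" where
  "P1_rat = insert Infinite (Finite ` \<rat>)"

lemma line_of_slope_inj: "line_of_slope s = line_of_slope t \<Longrightarrow> s = t"
proof -
  assume eq: "line_of_slope s = line_of_slope t"
  have *: "v \<in> vec.span {w} \<longleftrightarrow> (\<exists>c. v $ 1 = c * w $ 1 \<and> v $ 2 = c * w $ 2)" for v w :: "complex^2"
    by (auto simp: vec.span_singleton vec_eq_iff forall_2 image_iff)
  have sub: "w \<in> vec.span {v}" if "vec.span {w} = vec.span {v}" for v w :: "complex^2"
    using that vec.span_base[of w "{w}"] by auto
  show "s = t"
    using eq by (cases s; cases t) (auto dest!: sub simp: * simp del: vec.span_singleton)
qed

lemma slope_of_line_of_slope [simp]: "slope_of (line_of_slope s) = s"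
  unfolding slope_of_def using line_of_slope_inj by (intro the_equality) auto

lemma complex_line_iff: "complex_line l \<longleftrightarrow> (\<exists>s. l = line_of_slope s)"
proof
  assume l: "complex_line l"
  then obtain b where b: "b \<subseteq> l" "vec.independent b" "l \<subseteq> vec.span b" "card b = 1"
    by (metis complex_line_def vec.basis_exists)
  then obtain v where v: "b = {v}" by (auto simp: card_1_singleton_iff)
  have lv: "l = vec.span {v}"
    using b v l vec.span_minimal[of b l] by (auto simp: complex_line_def)
  have v0: "v \<noteq> 0" using b v vec.dependent_zero by auto
  have sc: "vec.span {v} = vec.span {w}" if "v = c *s w" "c \<noteq> 0" for c :: complex and w
  proof -
    have "w = inverse c *s v" using that by (simp add: vector_smult_assoc)
    then have "w \<in> vec.span {v}" by (metis vec.span_base vec.span_scale singletonI)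
    moreover have "v \<in> vec.span {w}" using that by (metis vec.span_base vec.span_scale singletonI)
    ultimately show ?thesis by (auto simp only: vec.span_eq insert_subset empty_subsetI)
  qed
  show "\<exists>s. l = line_of_slope s"
  proof (cases "v $ 2 = 0")
    case True
    then have "v = v $ 1 *s vector [1, 0]" "v $ 1 \<noteq> 0"
      using v0 by (auto simp: vec_eq_iff forall_2)
    then show ?thesis using lv sc line_of_slope.simps(2) by metis
  next
    case False
    then have "v = v $ 2 *s vector [v $ 1 / v $ 2, 1]"
      by (auto simp: vec_eq_iff forall_2)
    then show ?thesis using lv sc False line_of_slope.simps(1) by metis
  qed
next
  assume "\<exists>s. l = line_of_slope s"
  then obtain w :: "complex^2" where w: "l = vec.span {w}" "w \<noteq> 0"
  proof (elim exE)
    fix s assume "l = line_of_slope s"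
    then show thesis
      using that by (cases s) (auto simp: vec_eq_iff forall_2)
  qed
  then show "complex_line l"
    using vec.dim_eq_card_independent[of "{w}"] by (simp add: complex_line_def)
qed

end

theory Submission
  imports Defs
begin

text \<open>
  Pull a line \<open>l\<close> back along the real isomorphism \<open>M \<mapsto> M (\<tau>, 1)\<close> to a real plane of
  matrices. Since a rational basis of \<open>B\<close> is a real basis of all matrices, the intersection of
  that plane with \<open>I\<close> has bounded denominators with respect to any two independent elements of
  \<open>B\<close> in the plane; so \<open>l\<close> gives an Abelian subvariety iff two such elements exist.
  For non-real slope \<open>z\<close> the nonzero matrices in the plane are the \<open>\<gamma>\<close> with \<open>\<gamma> \<tau> = z\<close>, and
  \<open>\<gamma>\<close>, \<open>\<gamma> J\<^sub>\<tau>\<close> span it; for real slope they are singular.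
\<close>

section \<open>Rank-two lattices in real vector spaces\<close>

text \<open>The conjunct \<open>x \<noteq> y\<close> belongs to the equivalence because
  \<open>{x, y}\<close> collapses to a singleton when \<open>x = y\<close>, and the singleton of a
  nonzero vector is independent as a set.\<close>

lemma independent_pair_iff:
  fixes x y :: "'a::real_vector"
  shows "x \<noteq> y \<and> independent {x, y} \<longleftrightarrow> (\<forall>a b. a *\<^sub>R x + b *\<^sub>R y = 0 \<longrightarrow> a = 0 \<and> b = 0)"
    (is "?L \<longleftrightarrow> ?R")
proof
  assume L: ?L
  show ?R
  proof (intro allI impI)
    fix a b assume "a *\<^sub>R x + b *\<^sub>R y = 0"
    with L have "\<forall>v\<in>{x, y}. (if v = x then a else b) = 0"
      by (intro ballI independentD[where s = "{x, y}" and t = "{x, y}"]) auto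
    with L show "a = 0 \<and> b = 0" by auto
  qed
next
  assume R: ?R
  have "x \<noteq> y"
    using R[rule_format, of 1 "-1"] by auto
  moreover have "independent {x, y}"
  proof (rule independent_if_scalars_zero)
    fix f v assume "(\<Sum>u\<in>{x, y}. f u *\<^sub>R u) = 0" "v \<in> {x, y}"
    then show "f v = 0"
      using R \<open>x \<noteq> y\<close> by auto
  qed simp
  ultimately show ?L by blast
qed

text \<open>Division with remainder by the least positive element of \<open>H\<close>. The form with
  \<open>dvd\<close> also covers the trivial subgroup, through \<open>e = 0\<close>.\<close>

lemma int_subgroup_principal:
  fixes H :: "int set"
  assumes "0 \<in> H" and diff: "\<And>i j. i \<in> H \<Longrightarrow> j \<in> H \<Longrightarrow> i - j \<in> H"
  obtains e where "\<And>i. i \<in> H \<longleftrightarrow> e dvd i"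
proof -
  have neg: "- i \<in> H" if "i \<in> H" for i
    using diff[OF \<open>0 \<in> H\<close> that] by simp
  have add: "i + j \<in> H" if "i \<in> H" "j \<in> H" for i j
    using diff[OF that(1) neg[OF that(2)]] by simp
  have natmul: "int n * i \<in> H" if "i \<in> H" for n i
    by (induction n) (auto simp: \<open>0 \<in> H\<close> algebra_simps that add)
  have mul: "k * i \<in> H" if "i \<in> H" for k i
    using natmul[OF that] neg[OF natmul[OF that]] by (cases k rule: int_cases2) auto
  show thesis
  proof (cases "H \<subseteq> {0}")
    case True
    then have "i \<in> H \<longleftrightarrow> 0 dvd i" for i using \<open>0 \<in> H\<close> by auto
    then show thesis by (rule that)
  next
    case False
    then obtain i where "i \<in> H" "i \<noteq> 0" by auto
    then have "\<exists>n. 0 < n \<and> int n \<in> H"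
      using neg by (intro exI[of _ "nat \<bar>i\<bar>"]) (auto simp: abs_if)
    then obtain n where n: "0 < n" "int n \<in> H" and least: "\<And>m. 0 < m \<Longrightarrow> int m \<in> H \<Longrightarrow> n \<le> m"
      unfolding exists_least_iff[of "\<lambda>n. 0 < n \<and> int n \<in> H"] by (meson not_le)
    have "int n dvd j" if "j \<in> H" for j
    proof -
      have "j mod int n = j - (j div int n) * int n"
        by (simp add: minus_div_mult_eq_mod)
      then have "j mod int n \<in> H"
        using diff[OF that mul[OF n(2)]] by simp
      have "\<not> 0 < nat (j mod int n)"
      proof
        assume "0 < nat (j mod int n)"
        with \<open>j mod int n \<in> H\<close> have "n \<le> nat (j mod int n)"
          by (intro least) auto
        with n(1) show False
          using pos_mod_bound[of "int n" j] by linarith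
      qed
      then show ?thesis
        using n(1) pos_mod_sign[of "int n" j] unfolding dvd_eq_mod_eq_0 by linarith
    qed
    then have "j \<in> H \<longleftrightarrow> int n dvd j" for j
      using mul[OF n(2)] by (auto simp: dvd_def mult.commute)
    then show thesis by (rule that)
  qed
qed

lemma mem_int_span_pair:
  "z \<in> int_mod.span {x, y} \<longleftrightarrow> (\<exists>i j. z = of_int i *\<^sub>R x + of_int j *\<^sub>R y)"
proof -
  have "z - of_int i *\<^sub>R x - of_int j *\<^sub>R y = 0 \<longleftrightarrow> z = of_int i *\<^sub>R x + of_int j *\<^sub>R y" for i j
    by (simp add: diff_eq_eq add.commute)
  then show ?thesis
    unfolding int_mod.span_insert int_mod.span_empty by simp
qed

text \<open>A triangular basis as in the Hermite normal form: \<open>e\<close> generates the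
  integers \<open>i\<close> with \<open>i a\<close> in \<open>L\<close>, \<open>f\<close> generates
  the \<open>b\<close>-coordinates that occur in \<open>L\<close>, and \<open>e a\<close> together
  with some \<open>g a + f b\<close> generates \<open>L\<close>. The multiple \<open>m\<close> keeps
  \<open>e\<close> and \<open>f\<close> nonzero, so the rank is two and not smaller.\<close>

lemma lattice_of_rank_2I:
  fixes a b :: "'a::real_vector"
  assumes L: "int_mod.subspace L" and sub: "L \<subseteq> int_mod.span {a, b}"
    and ab: "a \<noteq> b" "independent {a, b}"
    and m: "m \<noteq> 0" "of_int m *\<^sub>R a \<in> L" "of_int m *\<^sub>R b \<in> L"
    and V: "L \<subseteq> V"
  shows "lattice_of_rank_in 2 V L"
proof -
  have ind: "s = 0 \<and> t = 0" if "s *\<^sub>R a + t *\<^sub>R b = 0" for s t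
    using that ab independent_pair_iff[of a b] by blast
  note clo = int_mod.subspace_add[OF L] int_mod.subspace_diff[OF L] int_mod.subspace_0[OF L]
    int_mod.subspace_scale[OF L]
  obtain e where "\<And>i. i \<in> {i. of_int i *\<^sub>R a \<in> L} \<longleftrightarrow> e dvd i"
    using clo by (elim int_subgroup_principal[rotated 2]) (auto simp: scaleR_diff_left)
  then have e: "of_int i *\<^sub>R a \<in> L \<longleftrightarrow> e dvd i" for i
    by simp
  obtain f where "\<And>j. j \<in> {j. \<exists>i. of_int i *\<^sub>R a + of_int j *\<^sub>R b \<in> L} \<longleftrightarrow> f dvd j"
  proof (rule int_subgroup_principal)
    let ?H = "{j. \<exists>i. of_int i *\<^sub>R a + of_int j *\<^sub>R b \<in> L}"
    show "0 \<in> ?H"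
      using clo(3) by (auto intro!: exI[of _ 0])
    fix j j' assume "j \<in> ?H" "j' \<in> ?H"
    then obtain i i' where "of_int i *\<^sub>R a + of_int j *\<^sub>R b \<in> L" "of_int i' *\<^sub>R a + of_int j' *\<^sub>R b \<in> L"
      by auto
    from clo(2)[OF this] show "j - j' \<in> ?H"
      by (auto intro!: exI[of _ "i - i'"] simp: algebra_simps)
  qed (rule that)
  then have f: "(\<exists>i. of_int i *\<^sub>R a + of_int j *\<^sub>R b \<in> L) \<longleftrightarrow> f dvd j" for j
    by simp
  have "e \<noteq> 0" using e[of m] m by auto
  have "\<exists>i. of_int i *\<^sub>R a + of_int m *\<^sub>R b \<in> L"
    using m by (intro exI[of _ 0]) simp
  with f[of m] m have "f \<noteq> 0" by auto
  obtain g where w: "of_int g *\<^sub>R a + of_int f *\<^sub>R b \<in> L" (is "?w \<in> L")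
    using f[of f] by auto
  let ?v = "of_int e *\<^sub>R a"
  have v: "?v \<in> L" using e[of e] by simp
  have "s = 0 \<and> t = 0" if "s *\<^sub>R ?v + t *\<^sub>R ?w = 0" for s t
    using ind[of "s * of_int e + t * of_int g" "t * of_int f"] that \<open>e \<noteq> 0\<close> \<open>f \<noteq> 0\<close>
    by (auto simp: algebra_simps)
  then have vw: "?v \<noteq> ?w" "independent {?v, ?w}"
    using independent_pair_iff[of ?v ?w] by blast+
  have "L \<subseteq> int_mod.span {?v, ?w}"
  proof
    fix z assume z: "z \<in> L"
    then obtain i j where ij: "z = of_int i *\<^sub>R a + of_int j *\<^sub>R b"
      using sub mem_int_span_pair by blast
    with z f[of j] have "f dvd j" by blast
    then obtain j' where j': "j = f * j'" by (rule dvdE)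
    \<comment> \<open>Subtracting this multiple of \<open>?w\<close> clears the
      \<open>b\<close>-coordinate and leaves an integer multiple of \<open>a\<close> in
      \<open>L\<close>.\<close>
    have "z - of_int j' *\<^sub>R ?w \<in> L" using clo z w by blast
    then have "of_int (i - j' * g) *\<^sub>R a \<in> L"
      by (simp add: ij j' algebra_simps)
    then obtain i' where i': "i - j' * g = e * i'" unfolding e by (rule dvdE)
    have "z = of_int (i - j' * g) *\<^sub>R a + of_int j' *\<^sub>R ?w"
      by (simp add: ij j' algebra_simps)
    then have "z = of_int i' *\<^sub>R ?v + of_int j' *\<^sub>R ?w"
      unfolding i' by (simp add: mult.commute)
    then show "z \<in> int_mod.span {?v, ?w}" using mem_int_span_pair by blast
  qed
  moreover have "int_mod.span {?v, ?w} \<subseteq> L"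
    using v w L by (intro int_mod.span_minimal) auto
  ultimately show ?thesis
    unfolding lattice_of_rank_in_def using vw v w V by (intro exI[of _ "{?v, ?w}"]) auto
qed

section \<open>Rational forms of real vector spaces and their plane lattices\<close>

text \<open>A rational form of the real space: the equal dimensions and the full real span together
  make every rational basis of \<open>B\<close> a real basis.\<close>

definition rational_structure :: "'a::euclidean_space set \<Rightarrow> bool" where
  "rational_structure B \<longleftrightarrow> rat_vs.subspace B \<and> rat_vs.dim B = DIM('a) \<and> span B = UNIV"

lemma independent_imp_rat_independent:
  assumes "independent S" shows "rat_vs.independent S"
proof -
  have "rat_vs.span T \<subseteq> span T" for T :: "'a set"
    by (intro rat_vs.span_minimal) (auto simp: rat_vs.subspace_def span_zero span_add span_scale span_base)
  with assms show ?thesis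
    unfolding dependent_def rat_vs.dependent_def by blast
qed

text \<open>Extend \<open>S\<close> to a rational basis of \<open>B\<close>. Its real span contains
  \<open>B\<close>, hence is everything, and it has as many elements as the real dimension; so it is
  also a real basis, and the rational coordinates of an element of \<open>B\<close> are its real
  ones.\<close>

lemma rational_basis_extend:
  fixes B :: "'a::euclidean_space set"
  assumes B: "rational_structure B" and S: "S \<subseteq> B" "independent S"
  obtains b where "S \<subseteq> b" "finite b" "independent b" "span b = UNIV"
    "\<And>z v. z \<in> B \<Longrightarrow> representation b z v \<in> \<rat>"
proof -
  obtain b where b: "S \<subseteq> b" "b \<subseteq> B" "rat_vs.independent b" "B \<subseteq> rat_vs.span b"
    using rat_vs.maximal_independent_subset_extend[OF S(1) independent_imp_rat_independent[OF S(2)]] .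
  have card: "card b = DIM('a)"
    using rat_vs.basis_card_eq_dim[OF b(2,4,3)] B by (simp add: rational_structure_def)
  then have fin: "finite b"
    by (intro card_ge_0_finite) simp
  have "rat_vs.span b \<subseteq> span b"
    by (intro rat_vs.span_minimal) (auto simp: rat_vs.subspace_def span_zero span_add span_scale span_base)
  with b(4) have "B \<subseteq> span b" by blast
  with B have sp: "span b = UNIV"
    unfolding rational_structure_def by (metis span_mono span_span top.extremum_uniqueI)
  have ind: "independent b"
    by (rule card_le_dim_spanning[where V = UNIV]) (auto simp: sp fin card)
  \<comment> \<open>The vectors with rational coordinates form a rational subspace that contains
    \<open>b\<close>.\<close>
  have "rat_vs.span b \<subseteq> {z. \<forall>v. representation b z v \<in> \<rat>}"
    by (intro rat_vs.span_minimal)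
       (auto simp: rat_vs.subspace_def representation_zero representation_add representation_scale
          representation_basis sp ind)
  with b(4) have "representation b z v \<in> \<rat>" if "z \<in> B" for z v
    using that by blast
  with b(1) fin ind sp show thesis by (rule that)
qed

lemma representation_pair:
  assumes "independent b" "{x, y} \<subseteq> b" "x \<noteq> y"
  shows "representation b (p *\<^sub>R x + q *\<^sub>R y) x = p" "representation b (p *\<^sub>R x + q *\<^sub>R y) y = q"
proof -
  have "representation b (p *\<^sub>R x + q *\<^sub>R y) = (\<lambda>v. p * (if v = x then 1 else 0) + q * (if v = y then 1 else 0))"
    using assms by (simp add: representation_add representation_scale representation_basis span_base span_scale)
  then show "representation b (p *\<^sub>R x + q *\<^sub>R y) x = p" "representation b (p *\<^sub>R x + q *\<^sub>R y) y = q"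
    using assms(3) by simp_all
qed

text \<open>The pair extends to a real basis in which elements of \<open>B\<close> have rational
  coordinates; \<open>p\<close> and \<open>q\<close>, a priori only real, are two of these
  coordinates.\<close>

lemma rational_structure_coords_rational:
  assumes "rational_structure B" "x \<in> B" "y \<in> B" "x \<noteq> y" "independent {x, y}"
    and "p *\<^sub>R x + q *\<^sub>R y \<in> B"
  shows "p \<in> \<rat>" "q \<in> \<rat>"
proof -
  obtain b where b: "{x, y} \<subseteq> b" "independent b" "\<And>z v. z \<in> B \<Longrightarrow> representation b z v \<in> \<rat>"
    by (rule rational_basis_extend[OF assms(1) _ assms(5)]) (use assms(2,3) in auto)
  show "p \<in> \<rat>" "q \<in> \<rat>"
    using b(3)[OF assms(6), of x] b(3)[OF assms(6), of y]
    by (simp_all add: representation_pair[OF b(2,1) assms(4)])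
qed

lemma Rats_common_denominator:
  fixes A :: "real set"
  assumes "finite A" "A \<subseteq> \<rat>"
  obtains N :: int where "N > 0" "\<And>q. q \<in> A \<Longrightarrow> of_int N * q \<in> \<int>"
proof -
  have "\<exists>N>0. \<forall>q\<in>A. of_int N * q \<in> \<int>"
    using assms
  proof (induction A)
    case (insert r A)
    then obtain N :: int where N: "N > 0" "\<forall>q\<in>A. of_int N * q \<in> \<int>" by auto
    obtain m n :: int where mn: "n > 0" "r = of_int m / of_int n"
      using insert.prems by (auto elim: Rats_cases')
    have "of_int (N * n) * q \<in> \<int>" if "q \<in> insert r A" for q
    proof (cases "q = r")
      case True
      then have "of_int (N * n) * q = of_int (N * m)" using mn by simp
      then show ?thesis by (metis Ints_of_int)
    next
      case False
      then have "of_int n * (of_int N * q) \<in> \<int>"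
        using that False N(2) by (meson Ints_mult Ints_of_int insertE)
      then show ?thesis by (metis of_int_mult mult.assoc mult.commute)
    qed
    then show ?case using N(1) mn(1) by (intro exI[of _ "N * n"]) auto
  qed (auto intro: exI[of _ 1])
  then show thesis using that by blast
qed

text \<open>The denominators of a rational combination of elements of \<open>I\<close> are cleared
  one term at a time, and they multiply.\<close>

lemma rat_span_subgroup_multiple:
  assumes I: "int_mod.subspace I" and x: "x \<in> rat_vs.span I"
  obtains k :: int where "k > 0" "of_int k *\<^sub>R x \<in> I"
proof -
  have "\<exists>k>0. of_int k *\<^sub>R x \<in> I"
    using x
  proof (induction rule: rat_vs.span_induct_alt)
    case base
    then show ?case using int_mod.subspace_0[OF I] by (auto intro: exI[of _ 1])
  next
    case (step c x y)
    then obtain k where k: "k > 0" "of_int k *\<^sub>R y \<in> I" by auto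
    obtain m n where mn: "n > 0" "c = of_int m / of_int n"
      by (metis quotient_of_denom_pos' quotient_of_div surj_pair snd_conv)
    have "of_int (k * n) *\<^sub>R (real_of_rat c *\<^sub>R x + y) = of_int (k * m) *\<^sub>R x + of_int n *\<^sub>R (of_int k *\<^sub>R y)"
      using mn by (simp add: algebra_simps of_rat_divide)
    also have "\<dots> \<in> I"
      by (rule int_mod.subspace_add[OF I int_mod.subspace_scale[OF I step(1)] int_mod.subspace_scale[OF I k(2)]])
    finally show ?case using k(1) mn(1) by (intro exI[of _ "k * n"]) auto
  qed
  then show thesis using that by blast
qed

text \<open>Extend \<open>x\<close>, \<open>y\<close> to a basis \<open>b\<close> with rational
  coordinates on \<open>B\<close>. A common denominator \<open>N\<close> of the coordinates of the
  generators bounds the intersection from above by the lattice on \<open>x/N\<close>,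
  \<open>y/N\<close>. From below it contains nonzero integer multiples of \<open>x\<close> and
  \<open>y\<close>, since \<open>S\<close> spans \<open>B\<close> over the rationals.\<close>

lemma rational_plane_lattice:
  fixes B :: "'a::euclidean_space set"
  assumes B: "rational_structure B"
    and S: "finite S" "S \<subseteq> B" "rat_vs.span (int_mod.span S) = B"
    and xy: "x \<in> B" "y \<in> B" "x \<noteq> y" "independent {x, y}"
    and V: "V = span {x, y}"
  shows "lattice_of_rank_in 2 V (V \<inter> int_mod.span S)"
proof -
  let ?I = "int_mod.span S"
  have I: "int_mod.subspace ?I" by (rule int_mod.subspace_span)
  obtain b where b: "{x, y} \<subseteq> b" "finite b" "independent b" "span b = UNIV"
      "\<And>z v. z \<in> B \<Longrightarrow> representation b z v \<in> \<rat>"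
    using rational_basis_extend[OF B _ xy(4)] xy(1,2) by auto
  obtain N where N: "N > 0" "\<And>q. q \<in> (\<lambda>(z, v). representation b z v) ` (S \<times> b) \<Longrightarrow> of_int N * q \<in> \<int>"
  proof (rule Rats_common_denominator)
    show "finite ((\<lambda>(z, v). representation b z v) ` (S \<times> b))" using S b by auto
    show "(\<lambda>(z, v). representation b z v) ` (S \<times> b) \<subseteq> \<rat>" using S b(5) by auto
  qed auto
  \<comment> \<open>Integrality of the scaled coordinates survives integer combinations, so the
    finitely many generators decide it for all of \<open>?I\<close>.\<close>
  have "?I \<subseteq> {z. \<forall>v\<in>b. of_int N * representation b z v \<in> \<int>}" (is "_ \<subseteq> ?T")
  proof (rule int_mod.span_minimal)
    show "S \<subseteq> ?T" using N(2) by force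
    have "of_int c * of_int N * representation b z v \<in> \<int>" if "of_int N * representation b z v \<in> \<int>" for c z v
      using Ints_mult[OF Ints_of_int[of c] that] by (simp add: mult_ac)
    then show "int_mod.subspace ?T"
      by (auto simp: int_mod.subspace_def representation_zero representation_add representation_scale
          b(3,4) distrib_left mult_ac)
  qed
  then have denom: "of_int N * representation b z v \<in> \<int>" if "z \<in> ?I" "v \<in> b" for z v
    using that by blast
  let ?a = "(1 / of_int N) *\<^sub>R x" and ?c = "(1 / of_int N) *\<^sub>R y"
  have ind: "s = 0 \<and> t = 0" if "s *\<^sub>R x + t *\<^sub>R y = 0" for s t
    using that xy(3,4) independent_pair_iff[of x y] by blast
  have "s = 0 \<and> t = 0" if "s *\<^sub>R ?a + t *\<^sub>R ?c = 0" for s t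
    using ind[of "s / of_int N" "t / of_int N"] that N(1) by simp
  then have ac: "?a \<noteq> ?c" "independent {?a, ?c}"
    using independent_pair_iff[of ?a ?c] by blast+
  obtain k where k: "k > 0" "of_int k *\<^sub>R x \<in> ?I"
    using rat_span_subgroup_multiple[OF I] S(3) xy(1) by metis
  obtain l where l: "l > 0" "of_int l *\<^sub>R y \<in> ?I"
    using rat_span_subgroup_multiple[OF I] S(3) xy(2) by metis
  have xyV: "x \<in> V" "y \<in> V" and VS: "subspace V"
    unfolding V by (auto simp: span_base)
  \<comment> \<open>In \<open>m\<close> the factor \<open>N\<close> cancels the denominator of
    \<open>?a\<close> and \<open>?c\<close>, and \<open>k * l\<close> moves both \<open>x\<close>
    and \<open>y\<close> into \<open>?I\<close>.\<close>
  show ?thesis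
  proof (rule lattice_of_rank_2I[OF _ _ ac, where m = "N * (k * l)"])
    show "int_mod.subspace (V \<inter> ?I)"
      using VS I by (auto simp: int_mod.subspace_def subspace_add subspace_scale subspace_0)
    show "V \<inter> ?I \<subseteq> int_mod.span {?a, ?c}"
    proof
      fix z assume z: "z \<in> V \<inter> ?I"
      then obtain p q where pq: "z = p *\<^sub>R x + q *\<^sub>R y"
        unfolding V by (auto simp: span_insert algebra_simps eq_diff_eq)
      from z have "of_int N * p \<in> \<int>" "of_int N * q \<in> \<int>"
        using denom[of z x] denom[of z y] b(1) representation_pair[OF b(3,1) xy(3), of p q] pq by auto
      then obtain i j where "of_int N * p = of_int i" "of_int N * q = of_int j"
        by (auto elim!: Ints_cases)
      then have "p = of_int i / of_int N" "q = of_int j / of_int N"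
        using N(1) by (simp_all add: eq_divide_eq mult.commute)
      then have "z = of_int i *\<^sub>R ?a + of_int j *\<^sub>R ?c"
        unfolding pq by simp
      then show "z \<in> int_mod.span {?a, ?c}" using mem_int_span_pair by blast
    qed
    show "N * (k * l) \<noteq> 0" using N(1) k(1) l(1) by simp
    have "of_int l *\<^sub>R (of_int k *\<^sub>R x) \<in> ?I" "of_int k *\<^sub>R (of_int l *\<^sub>R y) \<in> ?I"
      using int_mod.subspace_scale[OF I k(2), of l] int_mod.subspace_scale[OF I l(2), of k] by auto
    then show "of_int (N * (k * l)) *\<^sub>R ?a \<in> V \<inter> ?I" "of_int (N * (k * l)) *\<^sub>R ?c \<in> V \<inter> ?I"
      using N(1) xyV VS by (auto simp: mult_ac subspace_scale)
  qed auto
qed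

section \<open>Complex lines and the period map\<close>

text \<open>Carries lattices from real matrices to complex vectors: a real-linear map is a
  homomorphism of groups, and injectivity preserves independence and the number of
  generators.\<close>

lemma lattice_of_rank_in_image:
  assumes f: "linear f" "inj f" and L: "lattice_of_rank_in n V L"
  shows "lattice_of_rank_in n (f ` V) (f ` L)"
proof -
  obtain S where S: "finite S" "card S = n" "S \<subseteq> V" "independent S" "L = int_mod.span S"
    using L unfolding lattice_of_rank_in_def by blast
  have hom: "module_hom (\<lambda>n x. of_int n *\<^sub>R x) (\<lambda>n x. of_int n *\<^sub>R x) f"
    by (intro module_hom.intro module_hom_axioms.intro int_mod.module_axioms)
       (simp_all add: linear_add linear_scale f)
  have "f ` L = int_mod.span (f ` S)"
    unfolding S(5) by (rule module_hom.span_image[OF hom, symmetric])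
  moreover have "independent (f ` S)"
    using S(4) f inj_on_subset[OF f(2)] by (intro linear_independent_injective_image) auto
  moreover have "card (f ` S) = n"
    using S(2) f(2) by (metis card_image inj_on_subset subset_UNIV)
  ultimately show ?thesis
    unfolding lattice_of_rank_in_def using S(1,3) by (intro exI[of _ "f ` S"]) auto
qed

lemma mem_line_of_slope:
  "v \<in> line_of_slope (Finite z) \<longleftrightarrow> v $ 1 = z * v $ 2"
  "v \<in> line_of_slope Infinite \<longleftrightarrow> v $ 2 = 0"
  by (auto simp: vec.span_singleton vec_eq_iff forall_2 image_iff mult.commute)

text \<open>The line is the image of the complex numbers under a real-linear map, so its real
  dimension is at most two and two independent vectors exhaust it.\<close>

lemma line_of_slope_eq_span:
  assumes "u \<in> line_of_slope s" "v \<in> line_of_slope s" "u \<noteq> v" "independent {u, v}"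
  shows "line_of_slope s = span {u, v}"
proof -
  obtain w where w: "line_of_slope s = range (\<lambda>c. c *s w)"
    by (cases s) (auto simp: vec.span_singleton)
  have lin: "linear (\<lambda>c::complex. c *s w)"
    by (rule linearI) (simp_all add: vec_eq_iff algebra_simps)
  have "dim (line_of_slope s) \<le> card {u, v}"
    unfolding w using dim_image_le[OF lin, of UNIV] assms(3) by simp
  then have "line_of_slope s \<subseteq> span {u, v}"
    using assms by (intro card_ge_dim_independent) auto
  moreover have "subspace (line_of_slope s)"
    unfolding w by (intro linear_subspace_image[OF lin] subspace_UNIV)
  then have "span {u, v} \<subseteq> line_of_slope s"
    using assms by (intro span_minimal) auto
  ultimately show ?thesis by blast
qed

definition period_map :: "complex \<Rightarrow> real^2^2 \<Rightarrow> complex^2" where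
  "period_map \<tau> M = complexify M *v vector [\<tau>, 1]"

lemma period_map_nth [simp]:
  "period_map \<tau> M $ i = of_real (M $ i $ 1) * \<tau> + of_real (M $ i $ 2)"
  by (simp add: period_map_def complexify_def matrix_vector_mult_def sum_2)

lemma linear_period_map: "linear (period_map \<tau>)"
  by (rule linearI) (simp_all add: vec_eq_iff algebra_simps scaleR_conv_of_real[where 'a = complex])

text \<open>A nonreal \<tau> is independent of 1 over the reals; this turns a complex equation for a
  row of a matrix into equations for its entries.\<close>

lemma real_affine_eq_0_iff:
  assumes "Im \<tau> \<noteq> 0"
  shows "of_real p * \<tau> + of_real q = 0 \<longleftrightarrow> p = 0 \<and> q = 0"
  using assms by (auto simp: complex_eq_iff)

lemma inj_period_map:
  assumes "Im \<tau> \<noteq> 0"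
  shows "inj (period_map \<tau>)"
proof -
  have "M = 0" if "period_map \<tau> M = 0" for M
    using that by (auto simp: vec_eq_iff forall_2 real_affine_eq_0_iff[OF assms] simp del: add_eq_0_iff)
  then show ?thesis
    using linear_injective_0[OF linear_period_map] by blast
qed

lemma period_lattice_eq: "period_lattice I \<tau> = period_map \<tau> ` I"
  by (simp add: period_lattice_def period_map_def)

lemma quaternion_algebra_rational_structure:
  "quaternion_algebra B \<Longrightarrow> rational_structure B"
  by (simp add: quaternion_algebra_def subalgebra_over_Q_def rational_structure_def)

text \<open>Turns the question into one about \<open>B\<close> alone: the right side does not
  mention \<open>I\<close>. Generators of the lattice have preimages in \<open>I\<close>.
  Conversely, two such elements span a real plane that the period map carries onto the line,
  together with the lattice found by \<open>rational_plane_lattice\<close>.\<close>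

lemma gives_abelian_subvariety_iff:
  assumes B: "quaternion_algebra B" and I: "full_lattice B I" and \<tau>: "Im \<tau> \<noteq> 0"
  shows "gives_abelian_subvariety I \<tau> (line_of_slope s) \<longleftrightarrow>
    (\<exists>x\<in>B. \<exists>y\<in>B. x \<noteq> y \<and> independent {x, y} \<and>
       period_map \<tau> x \<in> line_of_slope s \<and> period_map \<tau> y \<in> line_of_slope s)"
    (is "?L \<longleftrightarrow> ?R")
proof
  let ?\<phi> = "period_map \<tau>" and ?l = "line_of_slope s"
  note lin = linear_period_map[of \<tau>] and inj = inj_period_map[OF \<tau>]
  assume ?L
  then obtain S where S: "card S = 2" "independent S" "?l \<inter> ?\<phi> ` I = int_mod.span S"
    unfolding gives_abelian_subvariety_def lattice_of_rank_in_def period_lattice_eq by blast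
  then obtain u v where uv: "S = {u, v}" "u \<noteq> v"
    by (auto simp: card_2_iff)
  have "u \<in> ?l \<inter> ?\<phi> ` I" "v \<in> ?l \<inter> ?\<phi> ` I"
    unfolding S(3) uv(1) by (auto intro: int_mod.span_base)
  then obtain x y where xy: "x \<in> I" "y \<in> I" "u = ?\<phi> x" "v = ?\<phi> y" "?\<phi> x \<in> ?l" "?\<phi> y \<in> ?l"
    by blast
  have "a = 0 \<and> b = 0" if "a *\<^sub>R x + b *\<^sub>R y = 0" for a b
  proof -
    have "a *\<^sub>R u + b *\<^sub>R v = 0"
      unfolding xy(3,4) using that lin by (metis linear_add linear_scale linear_0)
    then show ?thesis
      using S(2) uv independent_pair_iff[of u v] by blast
  qed
  then have "x \<noteq> y" "independent {x, y}"
    using independent_pair_iff[of x y] by blast+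
  with xy I show ?R
    unfolding full_lattice_def by blast
next
  let ?\<phi> = "period_map \<tau>" and ?l = "line_of_slope s"
  note lin = linear_period_map[of \<tau>] and inj = inj_period_map[OF \<tau>]
  assume ?R
  then obtain x y where xy: "x \<in> B" "y \<in> B" "x \<noteq> y" "independent {x, y}" "?\<phi> x \<in> ?l" "?\<phi> y \<in> ?l"
    by blast
  obtain S where S: "finite S" "int_mod.span S = I" and IB: "I \<subseteq> B" "rat_vs.span I = B"
    using I unfolding full_lattice_def by blast
  have SB: "S \<subseteq> B" using S(2) IB(1) int_mod.span_superset by blast
  have "?\<phi> x \<noteq> ?\<phi> y" using xy(3) inj by (auto dest: injD)
  moreover have "independent (?\<phi> ` {x, y})"
    using xy(4) lin inj_on_subset[OF inj] by (intro linear_independent_injective_image) auto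
  \<comment> \<open>The two images are independent vectors of the line, so they span it over the
    reals.\<close>
  ultimately have l: "?l = ?\<phi> ` span {x, y}"
    using line_of_slope_eq_span[OF xy(5,6)] linear_span_image[OF lin, of "{x, y}"] by simp
  have "lattice_of_rank_in 2 (span {x, y}) (span {x, y} \<inter> int_mod.span S)"
    using rational_plane_lattice[OF quaternion_algebra_rational_structure[OF B] S(1) SB _ xy(1-4) refl]
      S(2) IB(2) by blast
  from lattice_of_rank_in_image[OF lin inj this]
  show ?L
    unfolding gives_abelian_subvariety_def period_lattice_eq S(2) image_Int[OF inj] l[symmetric] .
qed

section \<open>Trace, conjugation and determinant of 2 by 2 matrices\<close>

lemma matrix_2x2_eq_iff:
  fixes M N :: "real^2^2"
  shows "M = N \<longleftrightarrow> M$1$1 = N$1$1 \<and> M$1$2 = N$1$2 \<and> M$2$1 = N$2$1 \<and> M$2$2 = N$2$2"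
  by (auto simp: vec_eq_iff forall_2)

lemma matrix_mult_2x2_nth:
  fixes M N :: "real^2^2"
  shows "(M ** N) $ i $ j = M$i$1 * N$1$j + M$i$2 * N$2$j"
  by (simp add: matrix_matrix_mult_def sum_2)

lemma mat_1_2x2_nth [simp]:
  "(mat 1 :: real^2^2)$1$1 = 1" "(mat 1 :: real^2^2)$1$2 = 0"
  "(mat 1 :: real^2^2)$2$1 = 0" "(mat 1 :: real^2^2)$2$2 = 1"
  by (simp_all add: mat_def)

lemmas matrix_2x2_simps = matrix_2x2_eq_iff matrix_mult_2x2_nth det_2 trace_def sum_2

text \<open>Written as a combination of \<open>M\<close> and the identity, so that the trace can be
  read off as a coordinate of \<open>M ** M\<close>.\<close>

lemma cayley_hamilton_2x2:
  fixes M :: "real^2^2"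
  shows "M ** M = trace M *\<^sub>R M + (- det M) *\<^sub>R mat 1"
  by (simp add: matrix_2x2_simps algebra_simps)

lemma J_mat_nth [simp]:
  "J_mat \<tau> $1$1 = Re \<tau> / Im \<tau>" "J_mat \<tau> $1$2 = - ((cmod \<tau>)\<^sup>2) / Im \<tau>"
  "J_mat \<tau> $2$1 = 1 / Im \<tau>" "J_mat \<tau> $2$2 = - Re \<tau> / Im \<tau>"
  by (simp_all add: J_mat_def)

lemma quaternion_algebra_closed:
  assumes "quaternion_algebra B"
  shows "mat 1 \<in> B" "x \<in> B \<Longrightarrow> y \<in> B \<Longrightarrow> x ** y \<in> B" "x \<in> B \<Longrightarrow> y \<in> B \<Longrightarrow> x - y \<in> B"
    "x \<in> B \<Longrightarrow> q \<in> \<rat> \<Longrightarrow> q *\<^sub>R x \<in> B"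
  using assms rat_vs.subspace_diff[of B x y] rat_vs.subspace_scale[of B x]
  unfolding quaternion_algebra_def subalgebra_over_Q_def by (auto elim!: Rats_cases)

text \<open>A nonscalar \<open>M\<close> and the identity are independent elements of
  \<open>B\<close>, and \<open>M ** M\<close> lies in \<open>B\<close>; by Cayley-Hamilton the trace
  is its coordinate at \<open>M\<close>.\<close>

lemma quaternion_trace_rational:
  assumes B: "quaternion_algebra B" and M: "M \<in> B" and nonscalar: "\<And>s. M \<noteq> s *\<^sub>R mat 1"
  shows "trace M \<in> \<rat>"
proof -
  have "a = 0 \<and> b = 0" if eq: "a *\<^sub>R M + b *\<^sub>R mat 1 = 0" for a b
  proof (cases "a = 0")
    case True
    with eq show ?thesis by (auto simp: matrix_2x2_eq_iff)
  next
    case False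
    have "M = (- b / a) *\<^sub>R mat 1"
      using eq False by (simp add: matrix_2x2_eq_iff field_simps add_eq_0_iff)
    with nonscalar show ?thesis by blast
  qed
  then have "M \<noteq> mat 1" "independent {M, mat 1}"
    using independent_pair_iff[of M "mat 1"] by blast+
  moreover have "trace M *\<^sub>R M + (- det M) *\<^sub>R mat 1 \<in> B"
    unfolding cayley_hamilton_2x2[symmetric] by (rule quaternion_algebra_closed[OF B]) (fact M)+
  ultimately show ?thesis
    using rational_structure_coords_rational(1)[OF quaternion_algebra_rational_structure[OF B] M]
      quaternion_algebra_closed(1)[OF B] by blast
qed

text \<open>This is the quaternion conjugate, whose product with \<open>M\<close> is
  \<open>det M\<close> times the identity. A scalar matrix is its own conjugate; otherwise the trace
  is rational.\<close>

lemma quaternion_conjugate_mem: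
  assumes B: "quaternion_algebra B" and M: "M \<in> B"
  shows "trace M *\<^sub>R mat 1 - M \<in> B"
proof (cases "\<exists>s. M = s *\<^sub>R mat 1")
  case True
  then have "trace M *\<^sub>R mat 1 - M = M"
    by (auto simp: matrix_2x2_simps)
  with M show ?thesis by simp
next
  case False
  then show ?thesis
    using quaternion_trace_rational[OF B M] quaternion_algebra_closed[OF B] M by blast
qed

text \<open>The assumption says that \<open>(\<tau>, 1)\<close> is an eigenvector of
  \<open>M\<close>. The real matrices with this property form the copy of the complex numbers
  spanned by the identity and \<open>J_mat \<tau>\<close>.\<close>

lemma fixed_point_J_mat:
  assumes \<tau>: "Im \<tau> \<noteq> 0" and fix_eq: "period_map \<tau> M $ 1 = \<tau> * period_map \<tau> M $ 2"
  shows "M = (trace M / 2) *\<^sub>R mat 1 + (M$2$1 * Im \<tau>) *\<^sub>R J_mat \<tau>"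
proof -
  define x y where "x = Re \<tau>" and "y = Im \<tau>"
  \<comment> \<open>The imaginary part of the eigenvector equation, then the real part; together
    they determine the upper row from the lower one.\<close>
  have "M$1$1 * y = 2 * x * y * M$2$1 + y * M$2$2"
    "M$1$1 * x + M$1$2 = (x\<^sup>2 - y\<^sup>2) * M$2$1 + x * M$2$2"
    using fix_eq by (simp_all add: x_def y_def complex_eq_iff power2_eq_square algebra_simps)
  moreover have "y \<noteq> 0" using \<tau> by (simp add: y_def)
  ultimately have e: "M$1$1 = 2 * x * M$2$1 + M$2$2"
    "M$1$2 = - (x\<^sup>2 + y\<^sup>2) * M$2$1"
    by algebra+
  have n: "(cmod \<tau>)\<^sup>2 = x\<^sup>2 + y\<^sup>2" by (simp add: cmod_power2 x_def y_def)
  show ?thesis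
    using \<tau> by (simp add: matrix_2x2_simps n e flip: x_def) (simp add: field_simps)
qed

text \<open>A nonzero singular real matrix has rank one, so it sends \<open>(\<tau>, 1)\<close> to a
  complex multiple of a real vector, whose slope is real or infinite.\<close>

lemma det_nonzero_of_nonreal_slope:
  assumes \<tau>: "Im \<tau> \<noteq> 0" and M: "M \<noteq> 0" "period_map \<tau> M \<in> line_of_slope (Finite z)" and z: "z \<notin> \<real>"
  shows "det M \<noteq> 0"
proof
  assume det: "det M = 0"
  let ?k = "of_real (M$2$1) * \<tau> + of_real (M$2$2) :: complex"
  have eq: "of_real (M$1$1) * \<tau> + of_real (M$1$2) = z * ?k"
    using M(2) by (simp add: mem_line_of_slope del: line_of_slope.simps)
  have d: "complex_of_real (M$1$1) * of_real (M$2$2) = of_real (M$1$2) * of_real (M$2$1)"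
    using det by (simp add: det_2 flip: of_real_mult)
  have k0: "?k \<noteq> 0"
  proof
    assume "?k = 0"
    with eq have "of_real (M$1$1) * \<tau> + of_real (M$1$2) = 0" by simp
    with \<open>?k = 0\<close> have "M = 0"
      unfolding real_affine_eq_0_iff[OF \<tau>] by (simp add: matrix_2x2_eq_iff)
    with M(1) show False by blast
  qed
  \<comment> \<open>After multiplying out and inserting \<open>eq\<close>, the first product is
    \<open>- det M\<close> and the second is \<open>det M\<close> times \<tau>.\<close>
  have "(z * of_real (M$2$1) - of_real (M$1$1)) * ?k = 0"
    "(z * of_real (M$2$2) - of_real (M$1$2)) * ?k = 0"
    using eq d by algebra+
  with k0 have "z * of_real (M$2$1) = of_real (M$1$1)" "z * of_real (M$2$2) = of_real (M$1$2)"
    by simp_all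
  moreover have "M$2$1 \<noteq> 0 \<or> M$2$2 \<noteq> 0" using k0 by auto
  ultimately have "z = of_real (M$1$1 / M$2$1) \<or> z = of_real (M$1$2 / M$2$2)"
    by (auto simp: eq_divide_eq)
  with z show False by auto
qed

text \<open>For real slope \<open>r\<close> the upper row minus \<open>r\<close> times the lower row
  annihilates \<open>(\<tau>, 1)\<close>, hence vanishes; for infinite slope the lower row itself
  vanishes.\<close>

lemma det_eq_0_of_real_slope:
  assumes \<tau>: "Im \<tau> \<noteq> 0" and s: "s \<in> P1_real" and M: "period_map \<tau> M \<in> line_of_slope s"
  shows "det M = 0"
proof (cases s)
  case (Finite z)
  with s obtain r where r: "z = of_real r" by (auto simp: P1_real_def elim: Reals_cases)
  have "of_real (M$1$1 - r * M$2$1) * \<tau> + of_real (M$1$2 - r * M$2$2) = 0"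
    using M by (simp add: Finite r mem_line_of_slope algebra_simps del: line_of_slope.simps)
  then show ?thesis
    unfolding real_affine_eq_0_iff[OF \<tau>] by (simp add: det_2)
next
  case Infinite
  with M have "of_real (M$2$1) * \<tau> + of_real (M$2$2) = 0"
    by (simp add: mem_line_of_slope del: line_of_slope.simps)
  then show ?thesis
    unfolding real_affine_eq_0_iff[OF \<tau>] by (simp add: det_2)
qed

section \<open>Slopes of lines giving Abelian subvarieties\<close>

text \<open>\<open>J_mat \<tau>\<close> multiplies \<open>(\<tau>, 1)\<close> by the imaginary unit.
  So \<gamma> and its product with the multiple of \<open>J_mat \<tau>\<close> in \<open>B\<close>
  send \<open>(\<tau>, 1)\<close> to a nonzero vector and a nonzero imaginary multiple of it: the
  same complex line, but independent over the reals.\<close>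

lemma has_CM_gives_abelian_subvariety:
  assumes B: "quaternion_algebra B" and I: "full_lattice B I" and \<tau>: "Im \<tau> \<noteq> 0"
    and CM: "has_CM B \<tau>" and \<gamma>: "\<gamma> \<in> B" "det \<gamma> \<noteq> 0"
  shows "gives_abelian_subvariety I \<tau> (line_of_slope (Finite (act \<gamma> \<tau>)))"
proof -
  obtain r where r: "r \<noteq> 0" "r *\<^sub>R J_mat \<tau> \<in> B"
    using CM unfolding has_CM_def by blast
  let ?y = "\<gamma> ** (r *\<^sub>R J_mat \<tau>)" and ?\<phi> = "period_map \<tau>"
  have J: "of_real (J_mat \<tau> $1$1) * \<tau> + of_real (J_mat \<tau> $1$2) = \<i> * \<tau>"
    "of_real (J_mat \<tau> $2$1) * \<tau> + of_real (J_mat \<tau> $2$2) = \<i>"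
    using \<tau> by (simp_all add: complex_eq_iff cmod_power2) (simp add: power2_eq_square field_simps)
  have y: "?\<phi> ?y $ i = \<i> * of_real r * ?\<phi> \<gamma> $ i" for i
  proof -
    have "?\<phi> ?y $ i = of_real r *
      (of_real (\<gamma>$i$1) * (of_real (J_mat \<tau> $1$1) * \<tau> + of_real (J_mat \<tau> $1$2)) +
       of_real (\<gamma>$i$2) * (of_real (J_mat \<tau> $2$1) * \<tau> + of_real (J_mat \<tau> $2$2)))"
      by (simp add: matrix_mult_2x2_nth algebra_simps del: J_mat_nth)
    then show ?thesis
      unfolding J by (simp add: algebra_simps)
  qed
  \<comment> \<open>An invertible \<gamma> has a nonzero lower row, so
    \<open>act \<gamma> \<tau>\<close> is a genuine quotient and not the default value of division
    by zero.\<close>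
  have k: "?\<phi> \<gamma> $ 2 \<noteq> 0"
    using \<gamma>(2) unfolding period_map_nth real_affine_eq_0_iff[OF \<tau>] by (auto simp: det_2)
  have \<gamma>l: "?\<phi> \<gamma> \<in> line_of_slope (Finite (act \<gamma> \<tau>))"
    using k by (simp add: mem_line_of_slope act_def moebius_def del: line_of_slope.simps)
  then have yl: "?\<phi> ?y \<in> line_of_slope (Finite (act \<gamma> \<tau>))"
    unfolding mem_line_of_slope y by (simp del: period_map_nth)
  have "a = 0 \<and> b = 0" if eq: "a *\<^sub>R \<gamma> + b *\<^sub>R ?y = 0" for a b
  proof -
    have "a *\<^sub>R ?\<phi> \<gamma> + b *\<^sub>R ?\<phi> ?y = ?\<phi> (a *\<^sub>R \<gamma> + b *\<^sub>R ?y)"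
      by (simp only: linear_add[OF linear_period_map] linear_scale[OF linear_period_map])
    also have "\<dots> = 0"
      unfolding eq by (rule linear_0[OF linear_period_map])
    finally have "(a *\<^sub>R ?\<phi> \<gamma> + b *\<^sub>R ?\<phi> ?y) $ 2 = 0"
      by simp
    then have "(of_real a + of_real (b * r) * \<i>) * ?\<phi> \<gamma> $ 2 = 0"
      unfolding vector_add_component vector_scaleR_component y scaleR_conv_of_real[where 'a = complex]
      by (simp add: algebra_simps del: period_map_nth)
    with k have "of_real a + of_real (b * r) * \<i> = 0"
      by simp
    with r(1) show ?thesis by (auto simp: complex_eq_iff)
  qed
  then have "\<gamma> \<noteq> ?y" "independent {\<gamma>, ?y}"
    using independent_pair_iff[of \<gamma> ?y] by blast+
  moreover have "?y \<in> B"
    using quaternion_algebra_closed(2)[OF B \<gamma>(1) r(2)] .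
  ultimately show ?thesis
    unfolding gives_abelian_subvariety_iff[OF B I \<tau>] using \<gamma>(1) \<gamma>l yl by blast
qed

text \<open>
  If \<open>x\<close> and \<open>y\<close> both map \<open>\<tau>\<close> to the same non-real point, then \<open>x\<^sup>* y\<close> fixes \<open>\<tau>\<close>,
  where \<open>x\<^sup>* = trace x - x\<close> is the conjugate; its trace-free part is a multiple of \<open>J\<^sub>\<tau>\<close>.
\<close>

lemma gives_abelian_subvariety_nonreal_imp:
  assumes B: "quaternion_algebra B" and I: "full_lattice B I" and \<tau>: "Im \<tau> \<noteq> 0"
    and z: "z \<notin> \<real>" and gives: "gives_abelian_subvariety I \<tau> (line_of_slope (Finite z))"
  shows "has_CM B \<tau>" "\<exists>\<gamma>\<in>B. det \<gamma> \<noteq> 0 \<and> act \<gamma> \<tau> = z"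
proof -
  let ?\<phi> = "period_map \<tau>" and ?l = "line_of_slope (Finite z)"
  obtain x y where xy: "x \<in> B" "y \<in> B" "x \<noteq> y" "independent {x, y}" "?\<phi> x \<in> ?l" "?\<phi> y \<in> ?l"
    using gives unfolding gives_abelian_subvariety_iff[OF B I \<tau>] by blast
  have "x \<noteq> 0" using xy(4) dependent_zero by blast
  have det: "det x \<noteq> 0"
    by (rule det_nonzero_of_nonreal_slope[OF \<tau> \<open>x \<noteq> 0\<close> xy(5) z])
  have k: "?\<phi> x $ 2 \<noteq> 0"
    using det unfolding period_map_nth real_affine_eq_0_iff[OF \<tau>] by (auto simp: det_2)
  have "act x \<tau> = z"
    using xy(5) k by (simp add: mem_line_of_slope act_def moebius_def del: line_of_slope.simps)
  with xy(1) det show "\<exists>\<gamma>\<in>B. det \<gamma> \<noteq> 0 \<and> act \<gamma> \<tau> = z" by blast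
  \<comment> \<open>Conjugate of \<open>x\<close> times \<open>y\<close>: up to the nonzero factor
    \<open>det x\<close> this is the inverse of \<open>x\<close> times \<open>y\<close>, but visibly
    an element of \<open>B\<close>.\<close>
  define w where "w = (trace x *\<^sub>R mat 1 - x) ** y"
  have wB: "w \<in> B"
    unfolding w_def using quaternion_conjugate_mem[OF B xy(1)] xy(2) by (rule quaternion_algebra_closed(2)[OF B])
  have xw: "x ** w = det x *\<^sub>R y"
    by (simp add: w_def matrix_2x2_simps algebra_simps)
  have w_nth: "w$1$1 = x$2$2 * y$1$1 - x$1$2 * y$2$1" "w$1$2 = x$2$2 * y$1$2 - x$1$2 * y$2$2"
    "w$2$1 = - x$2$1 * y$1$1 + x$1$1 * y$2$1" "w$2$2 = - x$2$1 * y$1$2 + x$1$1 * y$2$2"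
    by (simp_all add: w_def matrix_2x2_simps)
  \<comment> \<open>Both \<open>x\<close> and \<open>y\<close> send \<open>(\<tau>, 1)\<close> to
    multiples of \<open>(z, 1)\<close>, and the conjugate of \<open>x\<close> leads back to a
    multiple of \<open>(\<tau>, 1)\<close>. The factor \<open>?\<phi> x $ 2\<close> keeps the
    identity free of division.\<close>
  have "?\<phi> x $ 2 * (?\<phi> w $ 1 - \<tau> * ?\<phi> w $ 2) = 0"
  proof -
    have "?\<phi> x $ 1 = z * ?\<phi> x $ 2" "?\<phi> y $ 1 = z * ?\<phi> y $ 2"
      using xy(5,6) by (simp_all only: mem_line_of_slope)
    then show ?thesis
      unfolding period_map_nth w_nth of_real_add of_real_diff of_real_mult of_real_minus by algebra
  qed
  with k have "?\<phi> w $ 1 = \<tau> * ?\<phi> w $ 2" by (simp del: period_map_nth)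
  then have w: "w = (trace w / 2) *\<^sub>R mat 1 + (w$2$1 * Im \<tau>) *\<^sub>R J_mat \<tau>"
    by (rule fixed_point_J_mat[OF \<tau>])
  \<comment> \<open>If \<open>w\<close> were scalar, \<open>x ** w\<close> would make
    \<open>det x\<close> times \<open>y\<close> a multiple of \<open>x\<close>.\<close>
  have nonscalar: "w \<noteq> s *\<^sub>R mat 1" for s
  proof
    assume "w = s *\<^sub>R mat 1"
    with xw have "s *\<^sub>R x + (- det x) *\<^sub>R y = 0"
      by (simp add: matrix_2x2_eq_iff matrix_mult_2x2_nth mult.commute)
    with xy(3,4) have "- det x = 0"
      using independent_pair_iff[of x y] by blast
    with det show False by simp
  qed
  have "w$2$1 * Im \<tau> \<noteq> 0"
    using w nonscalar[of "trace w / 2"] by auto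
  moreover have "(w$2$1 * Im \<tau>) *\<^sub>R J_mat \<tau> \<in> B"
  proof -
    \<comment> \<open>Rationality of the trace allows the scalar part of \<open>w\<close> to be
      split off inside \<open>B\<close>.\<close>
    have "trace w / 2 \<in> \<rat>"
      using quaternion_trace_rational[OF B wB nonscalar] by simp
    then have "w - (trace w / 2) *\<^sub>R mat 1 \<in> B"
      using quaternion_algebra_closed[OF B] wB by blast
    moreover have "w - (trace w / 2) *\<^sub>R mat 1 = (w$2$1 * Im \<tau>) *\<^sub>R J_mat \<tau>"
      using w by (metis add_diff_cancel_left')
    ultimately show ?thesis by simp
  qed
  ultimately show "has_CM B \<tau>"
    unfolding has_CM_def by blast
qed

text \<open>If the slope is a real number \<open>r\<close>, the upper row of \<open>x\<close> is
  \<open>r\<close> times the lower one, which makes \<open>r\<close> a quotient of rational entries.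
  Conversely, a rational slope is the direction of a rational column.\<close>

lemma gives_abelian_subvariety_M2Q_iff:
  assumes B: "quaternion_algebra M2Q" and I: "full_lattice M2Q I" and \<tau>: "Im \<tau> \<noteq> 0"
    and s: "s \<in> P1_real"
  shows "gives_abelian_subvariety I \<tau> (line_of_slope s) \<longleftrightarrow> s \<in> P1_rat"
proof
  assume "gives_abelian_subvariety I \<tau> (line_of_slope s)"
  then obtain x y where xy: "x \<in> M2Q" "independent {x, y}" "period_map \<tau> x \<in> line_of_slope s"
    unfolding gives_abelian_subvariety_iff[OF B I \<tau>] by blast
  have "x \<noteq> 0" using xy(2) dependent_zero by blast
  show "s \<in> P1_rat"
  proof (cases s)
    case (Finite z)
    with s obtain r where r: "z = of_real r" by (auto simp: P1_real_def elim: Reals_cases)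
    have "of_real (x$1$1 - r * x$2$1) * \<tau> + of_real (x$1$2 - r * x$2$2) = 0"
      using xy(3) by (simp add: Finite r mem_line_of_slope algebra_simps del: line_of_slope.simps)
    then have e: "x$1$1 = r * x$2$1" "x$1$2 = r * x$2$2"
      unfolding real_affine_eq_0_iff[OF \<tau>] by simp_all
    with \<open>x \<noteq> 0\<close> have "x$2$1 \<noteq> 0 \<or> x$2$2 \<noteq> 0"
      by (auto simp: matrix_2x2_eq_iff)
    with e have "r = x$1$1 / x$2$1 \<or> r = x$1$2 / x$2$2"
      by auto
    with xy(1) have "r \<in> \<rat>"
      unfolding M2Q_def by (auto intro: Rats_divide)
    then show ?thesis
      unfolding P1_rat_def Finite r by (auto elim!: Rats_cases)
  qed (simp add: P1_rat_def)
next
  assume rat: "s \<in> P1_rat"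
  \<comment> \<open>Both witnesses have a single nonzero column, \<open>(q, 1)\<close> or
    \<open>(1, 0)\<close>, placed first in \<open>x\<close> and second in \<open>y\<close>; they
    send \<open>(\<tau>, 1)\<close> to \<tau> times this column and to the column itself.\<close>
  obtain x y where xy: "x \<in> M2Q" "y \<in> M2Q" "\<And>a b. a *\<^sub>R x + b *\<^sub>R y = 0 \<Longrightarrow> a = 0 \<and> b = 0"
    "period_map \<tau> x \<in> line_of_slope s" "period_map \<tau> y \<in> line_of_slope s"
  proof (cases s)
    case (Finite z)
    with rat obtain q where q: "z = of_rat q" by (auto simp: P1_rat_def elim: Rats_cases)
    have z: "z = of_real (of_rat q)"
      unfolding q by (cases q) (simp add: of_rat_rat)
    show thesis
      by (rule that[of "vector [vector [of_rat q, 0], vector [1, 0]]" "vector [vector [0, of_rat q], vector [0, 1]]"])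
         (simp_all add: M2Q_def forall_2 matrix_2x2_eq_iff Finite z mem_line_of_slope del: line_of_slope.simps)
  next
    case Infinite
    show thesis
      by (rule that[of "vector [vector [1, 0], vector [0, 0]]" "vector [vector [0, 1], vector [0, 0]]"])
         (simp_all add: M2Q_def forall_2 matrix_2x2_eq_iff Infinite mem_line_of_slope del: line_of_slope.simps)
  qed
  have "x \<noteq> y" "independent {x, y}"
    using xy(3) independent_pair_iff[of x y] by blast+
  with xy show "gives_abelian_subvariety I \<tau> (line_of_slope s)"
    unfolding gives_abelian_subvariety_iff[OF B I \<tau>] by blast
qed

text \<open>A real or infinite slope would produce a nonzero singular element of \<open>B\<close>,
  whereas nonzero elements are invertible.\<close>

lemma division_algebra_not_gives_abelian_subvariety:
  assumes B: "quaternion_algebra B" and I: "full_lattice B I" and \<tau>: "Im \<tau> \<noteq> 0"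
    and s: "s \<in> P1_real" and div: "division_algebra B"
  shows "\<not> gives_abelian_subvariety I \<tau> (line_of_slope s)"
proof
  assume "gives_abelian_subvariety I \<tau> (line_of_slope s)"
  then obtain x y where xy: "x \<in> B" "independent {x, y}" "period_map \<tau> x \<in> line_of_slope s"
    unfolding gives_abelian_subvariety_iff[OF B I \<tau>] by blast
  have "x \<noteq> 0" using xy(2) dependent_zero by blast
  with xy(1) div obtain u where "x ** u = mat 1"
    unfolding division_algebra_def by blast
  then have "det x * det u = 1"
    by (metis det_mul det_I)
  with det_eq_0_of_real_slope[OF \<tau> s xy(3)] show False by simp
qed

theorem theorem3p3:
  fixes B I :: "(real^2^2) set" and \<tau> :: complex
  assumes "quaternion_algebra B"
    and "full_lattice B I"
    and "\<tau> \<in> upper_half_plane"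
  shows
    "(has_CM B \<tau> \<longrightarrow>
        {l. complex_line l \<and> (\<exists>z. slope_of l = Finite z \<and> z \<notin> \<real>) \<and> gives_abelian_subvariety I \<tau> l}
        = {line_of_slope (Finite \<tau>0) | \<tau>0.
             \<tau>0 \<in> upper_half_plane \<union> lower_half_plane \<and> (\<exists>\<gamma>\<in>B. det \<gamma> \<noteq> 0 \<and> act \<gamma> \<tau> = \<tau>0)})
     \<and> (\<not> has_CM B \<tau> \<longrightarrow>
        (\<forall>l. complex_line l \<and> (\<exists>z. slope_of l = Finite z \<and> z \<notin> \<real>)
             \<longrightarrow> \<not> gives_abelian_subvariety I \<tau> l))
     \<and> (B = M2Q \<longrightarrow>
        (\<forall>l. complex_line l \<and> slope_of l \<in> P1_real
             \<longrightarrow> (gives_abelian_subvariety I \<tau> l \<longleftrightarrow> slope_of l \<in> P1_rat)))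
     \<and> (division_algebra B \<longrightarrow>
        (\<forall>l. complex_line l \<and> slope_of l \<in> P1_real
             \<longrightarrow> \<not> gives_abelian_subvariety I \<tau> l))"
proof -
  have \<tau>: "Im \<tau> \<noteq> 0"
    using assms(3) by (simp add: upper_half_plane_def)
  have nonreal: "z \<notin> \<real> \<longleftrightarrow> z \<in> upper_half_plane \<union> lower_half_plane" for z
    by (auto simp: upper_half_plane_def lower_half_plane_def complex_is_Real_iff)
  note nonreal_imp = gives_abelian_subvariety_nonreal_imp[OF assms(1,2) \<tau>]
  have CM_case: "{l. complex_line l \<and> (\<exists>z. slope_of l = Finite z \<and> z \<notin> \<real>) \<and> gives_abelian_subvariety I \<tau> l}
      = {line_of_slope (Finite \<tau>0) | \<tau>0.
           \<tau>0 \<in> upper_half_plane \<union> lower_half_plane \<and> (\<exists>\<gamma>\<in>B. det \<gamma> \<noteq> 0 \<and> act \<gamma> \<tau> = \<tau>0)}"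
    (is "?lhs = ?rhs") if CM: "has_CM B \<tau>"
  proof
    show "?lhs \<subseteq> ?rhs"
    proof
      fix l assume "l \<in> ?lhs"
      then obtain z where z: "l = line_of_slope (Finite z)" "z \<notin> \<real>" "gives_abelian_subvariety I \<tau> l"
        unfolding complex_line_iff by (auto simp del: line_of_slope.simps)
      then show "l \<in> ?rhs"
        using nonreal_imp(2)[OF z(2)] nonreal[of z] by blast
    qed
    show "?rhs \<subseteq> ?lhs"
    proof
      fix l assume "l \<in> ?rhs"
      then obtain \<gamma> where "l = line_of_slope (Finite (act \<gamma> \<tau>))" "act \<gamma> \<tau> \<notin> \<real>" "\<gamma> \<in> B" "det \<gamma> \<noteq> 0"
        unfolding nonreal by blast
      then show "l \<in> ?lhs"
        using has_CM_gives_abelian_subvariety[OF assms(1,2) \<tau> CM] complex_line_iff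
        by (auto simp del: line_of_slope.simps)
    qed
  qed
  \<comment> \<open>Contrapositive of the first part of \<open>nonreal_imp\<close>: a line of
    nonreal slope giving an Abelian subvariety forces CM.\<close>
  have no_CM_case: "\<not> gives_abelian_subvariety I \<tau> l"
    if "\<not> has_CM B \<tau>" "complex_line l \<and> (\<exists>z. slope_of l = Finite z \<and> z \<notin> \<real>)" for l
    using that nonreal_imp(1) unfolding complex_line_iff by (auto simp del: line_of_slope.simps)
  have M2Q_case: "gives_abelian_subvariety I \<tau> l \<longleftrightarrow> slope_of l \<in> P1_rat"
    if "B = M2Q" "complex_line l \<and> slope_of l \<in> P1_real" for l
    using that assms(1,2) gives_abelian_subvariety_M2Q_iff[OF _ _ \<tau>] unfolding complex_line_iff
    by (auto simp del: line_of_slope.simps)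
  have division_case: "\<not> gives_abelian_subvariety I \<tau> l"
    if "division_algebra B" "complex_line l \<and> slope_of l \<in> P1_real" for l
    using that division_algebra_not_gives_abelian_subvariety[OF assms(1,2) \<tau>] unfolding complex_line_iff
    by (auto simp del: line_of_slope.simps)
  show ?thesis
    by (intro conjI impI allI; (rule CM_case no_CM_case M2Q_case division_case; assumption))
qed

end
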